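(* Let $X$ be a nonempty locally compact Hausdorff space and let $(Y,d)$ be a non-discrete separable metric space. The following conditions are equivalent: (1) $MU(X,Y)$ is ccc; (2) $MU(X,Y)$ is locally ccc; (3) $X$ is discrete.
   Context: A map (multifunction) $F\colon X\to Y$ assigns to each $x\in X$ a subset $F(x)\subseteq Y$; for $A\subseteq X$ put $F(A)=\bigcup_{x\in A}F(x)$. Maps are identified with their graphs $\{(x,y): y\in F(x)\}$. $F$ is upper semicontinuous if for every $x\in X$ and every open $V\supseteq F(x)$ there is an open $U\ni x$ with $F(U)\subseteq V$. $F$ is usco if it is upper semicontinuous and every $F(x)$ is a nonempty compact set. $F$ is minimal usco if it is usco and its graph does not properly contain the graph of any other usco map from $X$ to $Y$. $MU(X,Y)$ is the set of all minimal usco maps from $X$ to $Y$. Let $K(Y)$ be the set of nonempty compact subsets of $Y$, and $H_d$ the Hausdorff metric on $K(Y)$. On $K(Y)^X$ the topology $\tau_{uc}$ of uniform convergence on compact sets is induced by the uniformity $\mathcal U_{uc}$ with base consisting of the sets $W[K,\varepsilon]=\{(F,G): H_d(F(x),G(x))<\varepsilon \text{ for every } x\in K\}$, where $K\subseteq X$ is compact and $\varepsilon>0$. $MU(X,Y)\subseteq K(Y)^X$ carries the subspace topology of $\tau_{uc}$. A space $Z$ is ccc if every family of pairwise disjoint open subsets of $Z$ is countable; $Z$ is locally ccc if every $z\in Z$ has a neighborhood which is a ccc subspace of $Z$. *)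

theory Defs
  imports "HOL-Analysis.Analysis"
begin

text \<open>A multifunction from \<open>X\<close> to \<open>Y\<close> is a function of type \<open>'a \<Rightarrow> 'b set\<close>; the spaces \<open>X\<close> and \<open>Y\<close>
  are the (automatically nonempty) universes of the types \<open>'a\<close> and \<open>'b\<close>.\<close>

definition multi_graph :: "('a \<Rightarrow> 'b set) \<Rightarrow> ('a \<times> 'b) set" where
  "multi_graph F = {(x, y). y \<in> F x}"

definition upper_semicontinuous ::
    "('a::topological_space \<Rightarrow> 'b::topological_space set) \<Rightarrow> bool" where
  "upper_semicontinuous F \<longleftrightarrow>
     (\<forall>x V. open V \<and> F x \<subseteq> V \<longrightarrow> (\<exists>U. open U \<and> x \<in> U \<and> (\<Union>u\<in>U. F u) \<subseteq> V))"

definition usco :: "('a::topological_space \<Rightarrow> 'b::topological_space set) \<Rightarrow> bool" where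
  "usco F \<longleftrightarrow> upper_semicontinuous F \<and> (\<forall>x. F x \<noteq> {} \<and> compact (F x))"

definition minimal_usco :: "('a::topological_space \<Rightarrow> 'b::topological_space set) \<Rightarrow> bool" where
  "minimal_usco F \<longleftrightarrow> usco F \<and> (\<nexists>G. usco G \<and> multi_graph G \<subset> multi_graph F)"

definition MU :: "('a::topological_space \<Rightarrow> 'b::topological_space set) set" where
  "MU = {F. minimal_usco F}"

definition nonempty_compacts :: "'b::topological_space set set" where
  "nonempty_compacts = {A. A \<noteq> {} \<and> compact A}"

text \<open>On nonempty compact sets both suprema are over bounded nonempty sets of reals, so this is
  the usual Hausdorff metric there; on other sets the value is irrelevant.\<close>

definition hausdorff_metric :: "'b::metric_space set \<Rightarrow> 'b set \<Rightarrow> real" where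
  "hausdorff_metric A B = max (SUP a\<in>A. infdist a B) (SUP b\<in>B. infdist b A)"

definition compact_valued :: "('a \<Rightarrow> 'b::topological_space set) set" where
  "compact_valued = {F. \<forall>x. F x \<in> nonempty_compacts}"

definition uc_entourage ::
    "'a::topological_space set \<Rightarrow> real \<Rightarrow> (('a \<Rightarrow> 'b::metric_space set) \<times> ('a \<Rightarrow> 'b set)) set" where
  "uc_entourage K \<epsilon> =
     {(F, G) \<in> compact_valued \<times> compact_valued. \<forall>x\<in>K. hausdorff_metric (F x) (G x) < \<epsilon>}"

definition uc_uniformity ::
    "(('a::topological_space \<Rightarrow> 'b::metric_space set) \<times> ('a \<Rightarrow> 'b set)) filter" where
  "uc_uniformity = (INF (K, \<epsilon>)\<in>{K. compact K} \<times> {0<..}. principal (uc_entourage K \<epsilon>))"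

lemma eventually_uc_uniformity:
  fixes P :: "('a::topological_space \<Rightarrow> 'b::metric_space set) \<times> ('a \<Rightarrow> 'b set) \<Rightarrow> bool"
  shows "eventually P uc_uniformity \<longleftrightarrow>
     (\<exists>K \<epsilon>. compact K \<and> \<epsilon> > 0 \<and> (\<forall>p\<in>uc_entourage K \<epsilon>. P p))"
proof -
  let ?W = "uc_entourage :: 'a set \<Rightarrow> real \<Rightarrow> (('a \<Rightarrow> 'b set) \<times> ('a \<Rightarrow> 'b set)) set"
  have base: "\<exists>c\<in>{K. compact K} \<times> {0<..}. (case c of (K, \<epsilon>) \<Rightarrow> principal (?W K \<epsilon>))
      \<le> inf (case a of (K, \<epsilon>) \<Rightarrow> principal (?W K \<epsilon>))
            (case b of (K, \<epsilon>) \<Rightarrow> principal (?W K \<epsilon>))"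
    if "a \<in> {K. compact K} \<times> {0<..}" "b \<in> {K. compact K} \<times> {0<..}"
    for a b :: "'a set \<times> real"
  proof -
    have "(fst a \<union> fst b, min (snd a) (snd b)) \<in> {K. compact K} \<times> {0<..}"
      using that by (auto simp: compact_Un)
    moreover have "?W (fst a \<union> fst b) (min (snd a) (snd b))
        \<subseteq> ?W (fst a) (snd a) \<inter> ?W (fst b) (snd b)"
      by (auto simp: uc_entourage_def)
    ultimately show ?thesis
      by (intro bexI[of _ "(fst a \<union> fst b, min (snd a) (snd b))"])
        (auto simp: case_prod_beta)
  qed
  have "({}, 1) \<in> {K::'a set. compact K} \<times> {0::real<..}" by simp
  then have "{K::'a set. compact K} \<times> {0::real<..} \<noteq> {}" by blast
  from eventually_INF_base[OF this base] show ?thesis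
    unfolding uc_uniformity_def by (auto simp: eventually_principal)
qed

text \<open>The topology induced by the uniformity, on the carrier \<open>compact_valued\<close>, in the manner of
  the library class \<open>open_uniformity\<close>.\<close>

definition uc_topology :: "('a::topological_space \<Rightarrow> 'b::metric_space set) topology" where
  "uc_topology = topology (\<lambda>\<U>. \<U> \<subseteq> compact_valued \<and>
     (\<forall>F\<in>\<U>. \<forall>\<^sub>F (F', G) in uc_uniformity. F' = F \<longrightarrow> G \<in> \<U>))"

lemma openin_uc_topology:
  "openin uc_topology \<U> \<longleftrightarrow> \<U> \<subseteq> compact_valued \<and>
     (\<forall>F\<in>\<U>. \<forall>\<^sub>F (F', G) in uc_uniformity. F' = F \<longrightarrow> G \<in> \<U>)"
proof -
  have "istopology (\<lambda>\<U>. \<U> \<subseteq> compact_valued \<and>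
     (\<forall>F\<in>\<U>. \<forall>\<^sub>F (F', G) in (uc_uniformity :: (('a \<Rightarrow> 'b set) \<times> _) filter). F' = F \<longrightarrow> G \<in> \<U>))"
    unfolding istopology_def
  proof (intro conjI allI impI ballI; (elim conjE)?)
    fix S T :: "('a \<Rightarrow> 'b set) set" and F
    assume "\<forall>F\<in>S. \<forall>\<^sub>F (F', G) in uc_uniformity. F' = F \<longrightarrow> G \<in> S"
      "\<forall>F\<in>T. \<forall>\<^sub>F (F', G) in uc_uniformity. F' = F \<longrightarrow> G \<in> T" "F \<in> S \<inter> T"
    then have "\<forall>\<^sub>F (F', G) in uc_uniformity. F' = F \<longrightarrow> G \<in> S"
      "\<forall>\<^sub>F (F', G) in uc_uniformity. F' = F \<longrightarrow> G \<in> T" by auto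
    then show "\<forall>\<^sub>F (F', G) in uc_uniformity. F' = F \<longrightarrow> G \<in> S \<inter> T"
      by eventually_elim auto
  next
    fix \<K> :: "('a \<Rightarrow> 'b set) set set" and F
    assume *: "\<forall>S\<in>\<K>. S \<subseteq> compact_valued \<and>
        (\<forall>F\<in>S. \<forall>\<^sub>F (F', G) in uc_uniformity. F' = F \<longrightarrow> G \<in> S)" and "F \<in> \<Union>\<K>"
    then obtain S where "S \<in> \<K>" "\<forall>\<^sub>F (F', G) in uc_uniformity. F' = F \<longrightarrow> G \<in> S" by blast
    then show "\<forall>\<^sub>F (F', G) in uc_uniformity. F' = F \<longrightarrow> G \<in> \<Union>\<K>"
      by (elim eventually_mono) auto
  qed auto
  then show ?thesis
    unfolding uc_topology_def by (simp add: topology_inverse')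
qed

lemma topspace_uc_topology: "topspace uc_topology = compact_valued"
proof -
  have "openin uc_topology (compact_valued :: ('a::topological_space \<Rightarrow> 'b::metric_space set) set)"
    unfolding openin_uc_topology eventually_uc_uniformity
    by (auto simp: uc_entourage_def intro!: exI[of _ "{}"] exI[of _ "1::real"])
  then show ?thesis
    unfolding topspace_def using openin_uc_topology by blast
qed

lemma MU_subset_compact_valued: "MU \<subseteq> compact_valued"
  by (auto simp: MU_def minimal_usco_def usco_def compact_valued_def nonempty_compacts_def)

definition MU_topology :: "('a::topological_space \<Rightarrow> 'b::metric_space set) topology" where
  "MU_topology = subtopology uc_topology MU"

definition ccc_space :: "'a topology \<Rightarrow> bool" where
  "ccc_space Z \<longleftrightarrow> (\<forall>\<U>. (\<forall>U\<in>\<U>. openin Z U) \<and> pairwise disjnt \<U> \<longrightarrow> countable \<U>)"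

definition locally_ccc_space :: "'a topology \<Rightarrow> bool" where
  "locally_ccc_space Z \<longleftrightarrow>
     (\<forall>z\<in>topspace Z. \<exists>U N. openin Z U \<and> z \<in> U \<and> U \<subseteq> N \<and> N \<subseteq> topspace Z \<and>
        ccc_space (subtopology Z N))"

end

theory Submission
  imports Defs "HOL-Probability.Probability"
begin

text \<open>If \<open>X\<close> is discrete, the minimal usco maps are the single-valued ones and compact sets are
  finite, so \<open>MU_topology\<close> is a continuous image of the product of copies of \<open>Y\<close> indexed by \<open>X\<close>.
  That product is ccc however large \<open>X\<close> is, because \<open>Y\<close> is separable
  (\<open>ccc_space_product_topology\<close>).

  If \<open>X\<close> has a nonisolated point, then a compact neighbourhood \<open>K\<close> of that point contains a sequence
  of disjoint nonempty open sets \<open>B n\<close>. Let \<open>y\<^sub>0\<close> be a nonisolated point of \<open>Y\<close> and \<open>y\<^sub>1\<close> another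
  point close to it. For each \<open>S :: nat set\<close> there is a minimal usco map with values in
  \<open>{y\<^sub>0, y\<^sub>1}\<close> that is \<open>{y\<^sub>1}\<close> on \<open>B n\<close> for \<open>n \<in> S\<close> and \<open>{y\<^sub>0}\<close> on the other \<open>B n\<close>
  (\<open>minimal_usco_two_valued_map\<close>). All these maps lie in a prescribed neighbourhood of the constant
  map \<open>{y\<^sub>0}\<close> once \<open>y\<^sub>1\<close> is close enough to \<open>y\<^sub>0\<close>, and any two of them are at distance
  \<open>dist y\<^sub>1 y\<^sub>0\<close> somewhere on \<open>K\<close>. Balls of half that radius, uniform over \<open>K\<close>, are then
  uncountably many disjoint open sets in the neighbourhood, so the space is not ccc locally at the
  constant map (\<open>not_locally_ccc_space_MU\<close>).\<close>

section \<open>The countable chain condition\<close>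

lemma locally_ccc_space_if_ccc_space:
  assumes "ccc_space Z"
  shows "locally_ccc_space Z"
  unfolding locally_ccc_space_def
  using assms by (intro ballI exI[of _ "topspace Z"]) auto

lemma ccc_space_continuous_map_image:
  assumes ccc: "ccc_space Z" and f: "continuous_map Z Z' f" and surj: "f ` topspace Z = topspace Z'"
  shows "ccc_space Z'"
  unfolding ccc_space_def
proof (intro allI impI, elim conjE)
  fix \<U> assume op: "\<forall>U\<in>\<U>. openin Z' U" and disj: "pairwise disjnt \<U>"
  define pre where "pre U = {z \<in> topspace Z. f z \<in> U}" for U
  have img: "f ` pre U = U" if "U \<in> \<U>" for U
    using openin_subset[of Z' U] op that surj by (auto simp: pre_def)
  have "\<forall>V\<in>pre ` \<U>. openin Z V"
    using op f by (auto simp: pre_def continuous_map_def)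
  moreover have "pairwise disjnt (pre ` \<U>)"
    using disj by (auto simp: pairwise_def disjnt_iff pre_def)
  ultimately have "countable (pre ` \<U>)"
    using ccc by (simp add: ccc_space_def)
  then have "countable ((`) f ` pre ` \<U>)"
    by (rule countable_image)
  also have "(`) f ` pre ` \<U> = \<U>"
    using img by (force simp: image_image)
  finally show "countable \<U>" .
qed

section \<open>Products of separable spaces\<close>

text \<open>For each \<open>n\<close>, fewer than \<open>n + 1\<close> of the sets can have probability above \<open>1 / (n + 1)\<close>.\<close>

lemma (in prob_space) countable_disjoint_positive_prob:
  assumes E: "\<And>s. s \<in> S \<Longrightarrow> E s \<in> events" and disj: "disjoint_family_on E S"
    and pos: "\<And>s. s \<in> S \<Longrightarrow> prob (E s) > 0"
  shows "countable S"
proof -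
  define L where "L n = {s \<in> S. prob (E s) > 1 / real (Suc n)}" for n
  have "finite (L n)" for n
  proof (rule ccontr)
    assume "infinite (L n)"
    then obtain T where T: "finite T" "card T = Suc n" "T \<subseteq> L n"
      using infinite_arbitrarily_large by blast
    then have "T \<subseteq> S" by (auto simp: L_def)
    have "1 = (\<Sum>s\<in>T. 1 / real (Suc n))" using T by simp
    also have "\<dots> < (\<Sum>s\<in>T. prob (E s))"
      using T by (intro sum_strict_mono) (auto simp: L_def)
    also have "\<dots> = prob (\<Union>s\<in>T. E s)"
      using T E \<open>T \<subseteq> S\<close> disjoint_family_on_mono[OF \<open>T \<subseteq> S\<close> disj]
      by (intro finite_measure_finite_Union[symmetric]) auto
    also have "\<dots> \<le> 1" by simp
    finally show False by simp
  qed
  then have "countable (\<Union>n. L n)"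
    by (intro countable_UN) (auto intro: countable_finite)
  moreover have "S \<subseteq> (\<Union>n. L n)"
  proof
    fix s assume "s \<in> S"
    with pos obtain n where "inverse (real (Suc n)) < prob (E s)"
      using reals_Archimedean by blast
    with \<open>s \<in> S\<close> show "s \<in> (\<Union>n. L n)" by (auto simp: L_def inverse_eq_divide)
  qed
  ultimately show ?thesis by (rule countable_subset[rotated])
qed

lemma separable_space_obtains_pmf:
  assumes sep: "separable_space X" and ne: "topspace X \<noteq> {}"
  obtains p where "\<And>V. openin X V \<Longrightarrow> V \<noteq> {} \<Longrightarrow> measure (measure_pmf p) V > 0"
proof -
  obtain C where C: "countable C" "C \<subseteq> topspace X" "X closure_of C = topspace X"
    using sep by (auto simp: separable_space_def)
  have "C \<noteq> {}" using C(3) ne by (metis closure_of_empty)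
  define p where "p = map_pmf (from_nat_into C) (geometric_pmf (1/2))"
  have set_p: "set_pmf p = C"
    using C \<open>C \<noteq> {}\<close> by (simp add: p_def set_pmf_geometric)
  have "measure (measure_pmf p) V > 0" if V: "openin X V" "V \<noteq> {}" for V
  proof -
    obtain v where "v \<in> V" using V by auto
    then have "v \<in> X closure_of C" using C(3) openin_subset[OF V(1)] by auto
    then have "C \<inter> V \<noteq> {}" using V \<open>v \<in> V\<close> by (force simp: in_closure_of)
    then show ?thesis
      using measure_pmf_zero_iff[of p V] set_p by (simp add: zero_less_measure_iff)
  qed
  then show ?thesis by (rule that)
qed

text \<open>Each factor carries a probability measure that charges all its nonempty open sets, namely one
  concentrated on a countable dense set. The product measure then charges every nonempty basic
  open set, since such a set restricts only finitely many coordinates; and a probability space has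
  no uncountable disjoint family of events of positive probability.\<close>

theorem ccc_space_product_topology:
  fixes X :: "'i \<Rightarrow> 'c topology"
  assumes sep: "\<And>i. i \<in> I \<Longrightarrow> separable_space (X i)"
  shows "ccc_space (product_topology X I)"
  unfolding ccc_space_def
proof (intro allI impI, elim conjE)
  fix \<U> assume op: "\<forall>U\<in>\<U>. openin (product_topology X I) U" and disj: "pairwise disjnt \<U>"
  define \<V> where "\<V> = \<U> - {{}}"
  have "countable \<V>"
  proof (cases "\<V> = {}")
    case False
    then obtain U\<^sub>0 where "U\<^sub>0 \<in> \<U>" "U\<^sub>0 \<noteq> {}" by (auto simp: \<V>_def)
    then obtain z where z: "z \<in> (\<Pi>\<^sub>E i\<in>I. topspace (X i))"
      using op openin_subset by fastforce
    have "\<exists>p. i \<in> I \<longrightarrow> (\<forall>V. openin (X i) V \<and> V \<noteq> {} \<longrightarrow> measure (measure_pmf p) V > 0)" for i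
    proof (cases "i \<in> I")
      case True
      then have "topspace (X i) \<noteq> {}" using z by auto
      then obtain q where "\<And>V. openin (X i) V \<Longrightarrow> V \<noteq> {} \<Longrightarrow> measure (measure_pmf q) V > 0"
        using separable_space_obtains_pmf[OF sep[OF True]] by blast
      then show ?thesis by blast
    qed simp
    then obtain p where p: "\<And>i V. i \<in> I \<Longrightarrow> openin (X i) V \<Longrightarrow> V \<noteq> {} \<Longrightarrow> measure (measure_pmf (p i)) V > 0"
      by metis
    interpret P: product_prob_space "\<lambda>i. measure_pmf (p i)" I
      by unfold_locales
    define box where "box U J A \<longleftrightarrow> finite J \<and> J \<subseteq> I \<and> (\<forall>i\<in>J. openin (X i) (A i) \<and> A i \<noteq> {}) \<and>
        {f \<in> (\<Pi>\<^sub>E i\<in>I. topspace (X i)). \<forall>i\<in>J. f i \<in> A i} \<subseteq> U" for U J A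
    have "\<exists>J A. box U J A" if "U \<in> \<V>" for U
    proof -
      have "U \<noteq> {}" "openin (product_topology X I) U"
        using that op by (auto simp: \<V>_def)
      then obtain f where "f \<in> U" "openin (product_topology X I) U"
        by blast
      then obtain A where A: "finite {i \<in> I. A i \<noteq> topspace (X i)}" "\<forall>i\<in>I. openin (X i) (A i)"
          "f \<in> Pi\<^sub>E I A" "Pi\<^sub>E I A \<subseteq> U"
        unfolding openin_product_topology_alt by meson
      define J where "J = {i \<in> I. A i \<noteq> topspace (X i)}"
      have "g \<in> U" if g: "g \<in> (\<Pi>\<^sub>E i\<in>I. topspace (X i))" "\<forall>i\<in>J. g i \<in> A i" for g
      proof -
        have "g i \<in> A i" if "i \<in> I" for i
          using g that by (cases "i \<in> J") (auto simp: J_def PiE_iff)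
        then have "g \<in> Pi\<^sub>E I A" using g(1) by (simp add: PiE_iff)
        then show ?thesis using A(4) by blast
      qed
      moreover have "finite J" "J \<subseteq> I" using A(1) by (auto simp: J_def)
      moreover have "openin (X i) (A i)" "A i \<noteq> {}" if "i \<in> J" for i
        using that A(2,3) by (auto simp: J_def PiE_iff)
      ultimately have "box U J A" by (auto simp: box_def)
      then show ?thesis by blast
    qed
    then obtain J A where "\<And>U. U \<in> \<V> \<Longrightarrow> box U (J U) (A U)"
      by metis
    then have JA: "\<And>U. U \<in> \<V> \<Longrightarrow> finite (J U)" "\<And>U. U \<in> \<V> \<Longrightarrow> J U \<subseteq> I"
        "\<And>U i. U \<in> \<V> \<Longrightarrow> i \<in> J U \<Longrightarrow> openin (X i) (A U i) \<and> A U i \<noteq> {}"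
        "\<And>U. U \<in> \<V> \<Longrightarrow> {f \<in> (\<Pi>\<^sub>E i\<in>I. topspace (X i)). \<forall>i\<in>J U. f i \<in> A U i} \<subseteq> U"
      unfolding box_def by blast+
    define M where "M = (\<Pi>\<^sub>M i\<in>I. measure_pmf (p i))"
    define E where "E U = {f \<in> space M. \<forall>i\<in>J U. f i \<in> A U i}" for U
    have prob_E: "emeasure M (E U) = (\<Prod>i\<in>J U. emeasure (measure_pmf (p i)) (A U i))" if "U \<in> \<V>" for U
      unfolding E_def M_def using JA(1,2)[OF that] by (intro P.emeasure_PiM_Collect) auto
    have pos_E: "P.prob (E U) > 0" if "U \<in> \<V>" for U
    proof -
      have "emeasure (measure_pmf (p i)) (A U i) \<noteq> 0" if "i \<in> J U" for i
        using p[of i "A U i"] JA(2,3)[OF \<open>U \<in> \<V>\<close>] that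
        by (force simp: measure_pmf.emeasure_eq_measure)
      then have "emeasure M (E U) \<noteq> 0"
        using prob_E[OF that] JA(1)[OF that] by (simp add: prod_zero_iff)
      then show ?thesis
        by (simp add: P.emeasure_eq_measure M_def zero_less_measure_iff)
    qed
    show ?thesis
    proof (rule P.countable_disjoint_positive_prob)
      fix U assume "U \<in> \<V>"
      show "E U \<in> P.events" "P.prob (E U) > 0"
        using pos_E[OF \<open>U \<in> \<V>\<close>] measure_notin_sets[of "E U" "\<Pi>\<^sub>M i\<in>I. measure_pmf (p i)"] by auto
    next
      show "disjoint_family_on E \<V>"
        unfolding disjoint_family_on_def
      proof (intro ballI impI, rule ccontr)
        fix U V assume UV: "U \<in> \<V>" "V \<in> \<V>" "U \<noteq> V" and "E U \<inter> E V \<noteq> {}"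
        then obtain f where f: "f \<in> E U" "f \<in> E V" by auto
        \<comment> \<open>The factors of the measure space may be larger than the \<open>topspace (X i)\<close>, so \<open>f\<close> is
          moved into the product of the latter at the coordinates that are unrestricted.\<close>
        define g where "g i = (if i \<in> J U \<union> J V then f i else z i)" for i
        have inA: "\<forall>i\<in>J U. f i \<in> A U i" "\<forall>i\<in>J V. f i \<in> A V i"
          using f by (auto simp: E_def)
        have top: "f i \<in> topspace (X i)" if "i \<in> J U \<union> J V" for i
          using that inA JA(3)[OF UV(1)] JA(3)[OF UV(2)] openin_subset by blast
        have "g \<in> (\<Pi>\<^sub>E i\<in>I. topspace (X i))"
          using top z JA(2)[OF UV(1)] JA(2)[OF UV(2)] by (auto simp: g_def PiE_iff extensional_def)
        moreover have "\<forall>i\<in>J U. g i \<in> A U i" "\<forall>i\<in>J V. g i \<in> A V i"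
          using inA by (auto simp: g_def)
        ultimately have "g \<in> U \<inter> V"
          using JA(4)[OF UV(1)] JA(4)[OF UV(2)] by blast
        then show False
          using disj UV by (auto simp: \<V>_def pairwise_def disjnt_def)
      qed
    qed
  qed simp
  then show "countable \<U>"
    by (simp add: \<V>_def)
qed

section \<open>The Hausdorff metric and the topology of uniform convergence on compact sets\<close>

lemma hausdorff_metric_le_iff:
  assumes "A \<in> nonempty_compacts" "B \<in> nonempty_compacts"
  shows "hausdorff_metric A B \<le> s \<longleftrightarrow> (\<forall>a\<in>A. infdist a B \<le> s) \<and> (\<forall>b\<in>B. infdist b A \<le> s)"
proof -
  have bdd: "bdd_above ((\<lambda>a. infdist a D) ` C)" if "C \<in> nonempty_compacts" for C D :: "'a set"
    using that
    by (intro bounded_imp_bdd_above compact_imp_bounded compact_continuous_image continuous_intros)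
      (auto simp: nonempty_compacts_def)
  show ?thesis
    using assms cSUP_le_iff[OF _ bdd[OF assms(1)]] cSUP_le_iff[OF _ bdd[OF assms(2)]]
    by (auto simp: hausdorff_metric_def nonempty_compacts_def)
qed

lemma hausdorff_metric_commute: "hausdorff_metric A B = hausdorff_metric B A"
  by (simp add: hausdorff_metric_def max.commute)

lemma hausdorff_metric_triangle:
  assumes A: "A \<in> nonempty_compacts" and B: "B \<in> nonempty_compacts" and C: "C \<in> nonempty_compacts"
  shows "hausdorff_metric A C \<le> hausdorff_metric A B + hausdorff_metric B C"
proof -
  have le: "infdist a C' \<le> infdist a B + s"
    if "\<forall>b\<in>B. infdist b C' \<le> s" for a s and C' :: "'a set"
  proof -
    have "infdist a C' - s \<le> (INF b\<in>B. dist a b)"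
    proof (rule cINF_greatest)
      fix b assume "b \<in> B"
      then show "infdist a C' - s \<le> dist a b"
        using infdist_triangle[of a C' b] that by force
    qed (use B in \<open>auto simp: nonempty_compacts_def\<close>)
    then show ?thesis using B by (simp add: infdist_notempty nonempty_compacts_def)
  qed
  have AB: "(\<forall>a\<in>A. infdist a B \<le> hausdorff_metric A B) \<and> (\<forall>b\<in>B. infdist b A \<le> hausdorff_metric A B)"
    using hausdorff_metric_le_iff[OF A B, of "hausdorff_metric A B"] by simp
  have BC: "(\<forall>b\<in>B. infdist b C \<le> hausdorff_metric B C) \<and> (\<forall>c\<in>C. infdist c B \<le> hausdorff_metric B C)"
    using hausdorff_metric_le_iff[OF B C, of "hausdorff_metric B C"] by simp
  show ?thesis
    unfolding hausdorff_metric_le_iff[OF A C]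
  proof (intro conjI ballI)
    fix a assume "a \<in> A"
    with AB le[of C "hausdorff_metric B C" a] BC
    show "infdist a C \<le> hausdorff_metric A B + hausdorff_metric B C" by fastforce
  next
    fix c assume "c \<in> C"
    with BC le[of A "hausdorff_metric A B" c] AB
    show "infdist c A \<le> hausdorff_metric A B + hausdorff_metric B C" by fastforce
  qed
qed

lemma hausdorff_metric_singletons [simp]: "hausdorff_metric {a} {b} = dist a b"
  by (simp add: hausdorff_metric_def dist_commute)

lemma hausdorff_metric_self:
  assumes "A \<in> nonempty_compacts"
  shows "hausdorff_metric A A \<le> 0"
  using assms by (simp add: hausdorff_metric_le_iff)

text \<open>Over an infinite \<open>K\<close>, the set of all \<open>G\<close> with \<open>hausdorff_metric (F x) (G x) < r\<close> on \<open>K\<close>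
  need not be open; a gap that is uniform in \<open>x\<close> makes it so.\<close>

definition uc_ball ::
    "'a::topological_space set \<Rightarrow> ('a \<Rightarrow> 'b::metric_space set) \<Rightarrow> real \<Rightarrow> ('a \<Rightarrow> 'b set) set" where
  "uc_ball K F r = {G \<in> compact_valued. \<exists>s<r. \<forall>x\<in>K. hausdorff_metric (F x) (G x) \<le> s}"

lemma openin_uc_ball:
  assumes "compact K" and F: "F \<in> compact_valued"
  shows "openin uc_topology (uc_ball K F r)"
  unfolding openin_uc_topology eventually_uc_uniformity
proof (intro conjI ballI)
  fix G assume G: "G \<in> uc_ball K F r"
  then obtain s where s: "s < r" "\<forall>x\<in>K. hausdorff_metric (F x) (G x) \<le> s"
    by (auto simp: uc_ball_def)
  have "G' \<in> uc_ball K F r" if G': "(G, G') \<in> uc_entourage K ((r - s) / 2)" for G'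
  proof -
    have "hausdorff_metric (F x) (G' x) \<le> (r + s) / 2" if "x \<in> K" for x
    proof -
      have "hausdorff_metric (F x) (G' x) \<le> hausdorff_metric (F x) (G x) + hausdorff_metric (G x) (G' x)"
        using F G' by (intro hausdorff_metric_triangle) (auto simp: uc_entourage_def compact_valued_def)
      also have "\<dots> \<le> s + (r - s) / 2"
        using s G' that by (intro add_mono) (auto simp: uc_entourage_def less_imp_le)
      finally show ?thesis by (simp add: field_simps)
    qed
    then show ?thesis
      using s(1) G' unfolding uc_ball_def
      by (auto simp: uc_entourage_def intro!: exI[of _ "(r + s) / 2"])
  qed
  then show "\<exists>K' \<epsilon>. compact K' \<and> \<epsilon> > 0 \<and>
      (\<forall>q\<in>uc_entourage K' \<epsilon>. case q of (F', G') \<Rightarrow> F' = G \<longrightarrow> G' \<in> uc_ball K F r)"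
    using assms(1) s(1) by (intro exI[of _ K] exI[of _ "(r - s) / 2"]) auto
qed (auto simp: uc_ball_def)

lemma uc_ball_centre:
  assumes "F \<in> compact_valued" "r > 0"
  shows "F \<in> uc_ball K F r"
  using assms hausdorff_metric_self by (force simp: uc_ball_def compact_valued_def intro!: exI[of _ 0])

lemma disjnt_uc_ball:
  assumes F: "F \<in> compact_valued" and F': "F' \<in> compact_valued" and x: "x \<in> K"
    and far: "2 * r \<le> hausdorff_metric (F x) (F' x)"
  shows "disjnt (uc_ball K F r) (uc_ball K F' r)"
  unfolding disjnt_iff
proof (intro allI notI, elim conjE)
  fix G assume "G \<in> uc_ball K F r" "G \<in> uc_ball K F' r"
  then have G: "G \<in> compact_valued"
    and "hausdorff_metric (F x) (G x) < r" "hausdorff_metric (F' x) (G x) < r"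
    using x by (force simp: uc_ball_def)+
  moreover have "hausdorff_metric (F x) (F' x) \<le> hausdorff_metric (F x) (G x) + hausdorff_metric (G x) (F' x)"
    using F F' G by (intro hausdorff_metric_triangle) (auto simp: compact_valued_def)
  ultimately show False
    using far by (simp add: hausdorff_metric_commute)
qed

lemma openin_MU_topology_obtains:
  assumes "openin MU_topology U" and "F \<in> U"
  obtains K \<epsilon> where "compact K" and "\<epsilon> > 0"
    and "\<And>G. G \<in> MU \<Longrightarrow> (\<And>x. x \<in> K \<Longrightarrow> hausdorff_metric (F x) (G x) < \<epsilon>) \<Longrightarrow> G \<in> U"
proof -
  obtain T where T: "openin uc_topology T" "U = T \<inter> MU"
    using assms(1) by (auto simp: MU_topology_def openin_subtopology)
  then have F: "F \<in> T" "F \<in> compact_valued"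
    using assms(2) MU_subset_compact_valued by auto
  obtain K \<epsilon> where K: "compact K" "\<epsilon> > 0"
    "\<forall>q\<in>uc_entourage K \<epsilon>. case q of (F', G) \<Rightarrow> F' = F \<longrightarrow> G \<in> T"
    using T(1) F(1) unfolding openin_uc_topology eventually_uc_uniformity by meson
  show ?thesis
  proof (rule that[OF K(1,2)])
    fix G assume G: "G \<in> MU" "\<And>x. x \<in> K \<Longrightarrow> hausdorff_metric (F x) (G x) < \<epsilon>"
    then have "(F, G) \<in> uc_entourage K \<epsilon>"
      using F MU_subset_compact_valued by (auto simp: uc_entourage_def)
    with K(3) G(1) T(2) show "G \<in> U" by auto
  qed
qed

lemma topspace_MU_topology: "topspace MU_topology = MU"
  using MU_subset_compact_valued by (auto simp: MU_topology_def topspace_uc_topology)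

section \<open>Discrete domains\<close>

text \<open>On a discrete space every function is continuous, so each selection of a usco map is already a
  usco map contained in it.\<close>

lemma MU_discrete_domain:
  assumes "\<And>x::'a::topological_space. open {x}"
  shows "(MU :: ('a \<Rightarrow> 'b::topological_space set) set) = range (\<lambda>f x. {f x})"
proof (intro equalityI subsetI)
  have usco: "usco (\<lambda>x. {f x})" for f :: "'a \<Rightarrow> 'b"
    unfolding usco_def upper_semicontinuous_def using assms by auto
  {
    fix F :: "'a \<Rightarrow> 'b set" assume F: "F \<in> MU"
    then have "\<forall>x. \<exists>y. y \<in> F x" by (auto simp: MU_def minimal_usco_def usco_def)
    then obtain f where f: "\<And>x. f x \<in> F x" by metis
    then have "multi_graph (\<lambda>x. {f x}) \<subseteq> multi_graph F"
      by (auto simp: multi_graph_def)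
    then have "multi_graph (\<lambda>x. {f x}) = multi_graph F"
      using F usco[of f] by (auto simp: MU_def minimal_usco_def)
    then have "F = (\<lambda>x. {f x})"
      by (auto simp: multi_graph_def set_eq_iff fun_eq_iff)
    then show "F \<in> range (\<lambda>f x. {f x})" by blast
  next
    fix F :: "'a \<Rightarrow> 'b set" assume "F \<in> range (\<lambda>f x. {f x})"
    then obtain f where F: "F = (\<lambda>x. {f x})" by blast
    have "multi_graph G = multi_graph F" if "usco G" "multi_graph G \<subseteq> multi_graph F" for G
    proof -
      have "G x = {f x}" for x
        using that by (auto simp: usco_def multi_graph_def F)
      then show ?thesis by (simp add: F multi_graph_def)
    qed
    then show "F \<in> MU"
      using usco[of f] F by (auto simp: MU_def minimal_usco_def)
  }
qed

lemma ccc_space_MU_if_discrete: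
  assumes discrete: "\<And>x::'a::topological_space. open {x}"
    and sep: "separable_space (euclidean :: 'b::metric_space topology)"
  shows "ccc_space (MU_topology :: ('a \<Rightarrow> 'b set) topology)"
proof (rule ccc_space_continuous_map_image)
  let ?Y = "product_topology (\<lambda>_::'a. euclidean :: 'b topology) UNIV"
  let ?f = "\<lambda>(f :: 'a \<Rightarrow> 'b) x. {f x}"
  show "ccc_space ?Y" using sep by (rule ccc_space_product_topology)
  show "?f ` topspace ?Y = topspace MU_topology"
    by (simp add: topspace_MU_topology MU_discrete_domain[OF discrete])
  have "openin ?Y {f. ?f f \<in> U}" if U: "openin MU_topology U" for U
    unfolding openin_product_topology_alt
  proof (intro ballI)
    fix f assume "f \<in> {f. ?f f \<in> U}"
    then obtain K \<epsilon> where K: "compact K" "\<epsilon> > 0"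
      "\<And>G. G \<in> MU \<Longrightarrow> (\<And>x. x \<in> K \<Longrightarrow> hausdorff_metric {f x} (G x) < \<epsilon>) \<Longrightarrow> G \<in> U"
      using openin_MU_topology_obtains[OF U, of "?f f"] by auto
    have "finite K"
    proof -
      obtain \<C> where "\<C> \<subseteq> range (\<lambda>x. {x})" "finite \<C>" "K \<subseteq> \<Union>\<C>"
        using compactE[OF K(1), of "range (\<lambda>x. {x})"] discrete by auto
      then show ?thesis
        by (metis (no_types, lifting) finite.emptyI finite.insertI finite_Union finite_subset imageE subsetD)
    qed
    define A where "A x = (if x \<in> K then ball (f x) \<epsilon> else UNIV)" for x
    have "finite {x. A x \<noteq> UNIV}"
      using \<open>finite K\<close> by (rule rev_finite_subset) (auto simp: A_def)
    moreover have "open (A x)" "f x \<in> A x" for x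
      using K(2) by (auto simp: A_def)
    moreover have "?f g \<in> U" if "\<forall>x. g x \<in> A x" for g
    proof (rule K(3))
      show "?f g \<in> MU" by (auto simp: MU_discrete_domain[OF discrete])
      show "hausdorff_metric {f x} {g x} < \<epsilon>" if "x \<in> K" for x
        using \<open>\<forall>x. g x \<in> A x\<close> that by (auto simp: A_def dest: spec[of _ x])
    qed
    ultimately show "\<exists>A. finite {i \<in> UNIV. A i \<noteq> topspace euclidean} \<and> (\<forall>i\<in>UNIV. openin euclidean (A i))
        \<and> f \<in> Pi\<^sub>E UNIV A \<and> Pi\<^sub>E UNIV A \<subseteq> {f. ?f f \<in> U}"
      by (intro exI[of _ A]) (auto simp: PiE_iff)
  qed
  then show "continuous_map ?Y MU_topology ?f"
    by (auto simp: continuous_map_def topspace_MU_topology MU_discrete_domain[OF discrete])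
qed

section \<open>Non-discrete domains\<close>

text \<open>Any open neighbourhood of \<open>x\<close> contains a second point, which can be separated from \<open>x\<close>: this
  splits off an open set \<open>V\<close> and leaves a smaller neighbourhood \<open>Q\<close> of \<open>x\<close>, disjoint from \<open>V\<close>, in
  which to continue.\<close>

lemma nonisolated_point_disjoint_open_sequence:
  fixes x :: "'a::t2_space"
  assumes nonisolated: "\<not> open {x}" and N: "open N" "x \<in> N"
  obtains U :: "nat \<Rightarrow> 'a set" where "\<And>n. open (U n)" "\<And>n. U n \<noteq> {}" "\<And>n. U n \<subseteq> N" "disjoint_family U"
proof -
  define P where "P VQ \<longleftrightarrow> (case VQ of (V, Q) \<Rightarrow>
    open V \<and> V \<noteq> {} \<and> V \<subseteq> N \<and> open Q \<and> x \<in> Q \<and> Q \<subseteq> N \<and> V \<inter> Q = {})" for VQ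
  have split: "\<exists>VQ. P VQ \<and> fst VQ \<union> snd VQ \<subseteq> W" if W: "open W" "x \<in> W" "W \<subseteq> N" for W
  proof -
    obtain w where "w \<in> W" "w \<noteq> x"
    proof -
      have "W \<noteq> {x}" using nonisolated W(1) by auto
      then show ?thesis using W(2) that by blast
    qed
    then obtain V Q where "open V" "open Q" "w \<in> V" "x \<in> Q" "V \<inter> Q = {}"
      using hausdorff by metis
    with W \<open>w \<in> W\<close> show ?thesis
      by (intro exI[of _ "(V \<inter> W, Q \<inter> W)"]) (auto simp: P_def)
  qed
  obtain h where h: "\<And>n. P (h n)" "\<And>n. fst (h (Suc n)) \<union> snd (h (Suc n)) \<subseteq> snd (h n)"
  proof -
    have "\<exists>h. \<forall>n. P (h n) \<and> fst (h (Suc n)) \<union> snd (h (Suc n)) \<subseteq> snd (h n)"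
    proof (rule dependent_nat_choice)
      show "\<exists>VQ. P VQ" using split N by blast
      show "\<exists>VQ'. P VQ' \<and> fst VQ' \<union> snd VQ' \<subseteq> snd VQ" if "P VQ" for VQ
        using that split[of "snd VQ"] by (auto simp: P_def case_prod_beta)
    qed
    then show ?thesis using that by blast
  qed
  have Q_antimono: "snd (h n) \<subseteq> snd (h m)" if "m \<le> n" for m n
    using h(2) by (intro lift_Suc_antimono_le[OF _ that, of "\<lambda>n. snd (h n)"]) auto
  have "fst (h m) \<inter> fst (h n) = {}" if "m < n" for m n
  proof -
    have "fst (h n) \<subseteq> snd (h m)"
      using h(2)[of "n - 1"] Q_antimono[of m "n - 1"] that by fastforce
    then show ?thesis using h(1)[of m] by (auto simp: P_def case_prod_beta)
  qed
  then have "disjoint_family (\<lambda>n. fst (h n))"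
    unfolding disjoint_family_on_def by (metis Int_commute linorder_neqE_nat)
  then show ?thesis
    using h(1) by (intro that[of "\<lambda>n. fst (h n)"]) (auto simp: P_def case_prod_beta)
qed

text \<open>The closure of the graph of the function that is \<open>b\<close> on \<open>W\<close> and \<open>a\<close> off \<open>closure W\<close>. For
  open \<open>W\<close>, this function is continuous and its domain is a dense open set.\<close>

definition two_valued_map :: "'a::topological_space set \<Rightarrow> 'b \<Rightarrow> 'b \<Rightarrow> 'a \<Rightarrow> 'b set" where
  "two_valued_map W a b x =
     {y. y = b \<and> x \<in> closure W \<or> y = a \<and> x \<notin> interior (closure W)}"

lemma minimal_usco_two_valued_map:
  fixes a b :: "'b::t1_space"
  assumes "open W" and "a \<noteq> b"
  shows "minimal_usco (two_valued_map W a b)"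
proof -
  let ?F = "two_valued_map W a b" and ?A = "closure W" and ?B = "- interior (closure W)"
  have sub: "?F x \<subseteq> {a, b}" for x by (auto simp: two_valued_map_def)
  have ne: "?F x \<noteq> {}" for x using interior_subset[of ?A] by (auto simp: two_valued_map_def)
  have W: "W \<subseteq> interior ?A"
    using assms(1) by (simp add: closure_subset interior_maximal)
  have usco: "usco ?F"
    unfolding usco_def upper_semicontinuous_def
  proof (intro conjI allI impI)
    fix x V assume V: "open V \<and> ?F x \<subseteq> V"
    \<comment> \<open>The complement of those among the two closed sets that do not contain \<open>x\<close>: no value
      outside \<open>?F x\<close> is taken there.\<close>
    let ?U = "(if x \<in> ?A then UNIV else - ?A) \<inter> (if x \<in> ?B then UNIV else - ?B)"
    have "open ?U" by (auto intro: open_Int)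
    moreover have "x \<in> ?U" by auto
    moreover have "?F u \<subseteq> ?F x" if "u \<in> ?U" for u
      using that by (auto simp: two_valued_map_def split: if_splits)
    ultimately show "\<exists>U. open U \<and> x \<in> U \<and> (\<Union>u\<in>U. ?F u) \<subseteq> V"
      using V by (intro exI[of _ ?U]) blast
  next
    fix x show "compact (?F x)"
      using sub[of x] by (intro finite_imp_compact) (rule finite_subset, auto)
  qed (rule ne)
  have "\<not> multi_graph G \<subset> multi_graph ?F" if G: "usco G" for G
  proof
    assume less: "multi_graph G \<subset> multi_graph ?F"
    have le: "G x \<subseteq> ?F x" for x using less by (auto simp: multi_graph_def)
    have Gne: "G x \<noteq> {}" for x using G by (auto simp: usco_def)
    have avoid: "\<exists>U. open U \<and> x \<in> U \<and> (\<forall>u\<in>U. c \<notin> G u)" if "c \<notin> G x" for x c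
    proof -
      have "open (- {c})" "G x \<subseteq> - {c}" using that by auto
      with G obtain U where "open U" "x \<in> U" "(\<Union>u\<in>U. G u) \<subseteq> - {c}"
        unfolding usco_def upper_semicontinuous_def by metis
      then show ?thesis by blast
    qed
    \<comment> \<open>\<open>?F\<close> is \<open>{b}\<close> on \<open>W\<close> and \<open>{a}\<close> off \<open>closure W\<close>, so \<open>G\<close> agrees with it there, and
      \<open>b\<close> and \<open>a\<close> spread by upper semicontinuity to the closures of these two open sets.\<close>
    have "b \<in> G x" if "x \<in> ?A" for x
    proof (rule ccontr)
      assume "b \<notin> G x"
      then obtain U where U: "open U" "x \<in> U" "\<forall>u\<in>U. b \<notin> G u" using avoid by blast
      then obtain u where "u \<in> U" "u \<in> W"
        using \<open>x \<in> ?A\<close> by (meson closure_iff_nhds_not_empty disjoint_iff order_refl)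
      then have "?F u \<subseteq> {b}" using W by (auto simp: two_valued_map_def)
      with le[of u] Gne[of u] U(3) \<open>u \<in> U\<close> show False by blast
    qed
    moreover have "a \<in> G x" if "x \<in> ?B" for x
    proof (rule ccontr)
      assume "a \<notin> G x"
      then obtain U where U: "open U" "x \<in> U" "\<forall>u\<in>U. a \<notin> G u" using avoid by blast
      have "U \<subseteq> ?A"
      proof
        fix u assume "u \<in> U"
        then have "b \<in> G u" using le[of u] Gne[of u] U(3) sub[of u] by blast
        then show "u \<in> ?A" using le[of u] assms(2) by (auto simp: two_valued_map_def)
      qed
      with U \<open>x \<in> ?B\<close> show False using interior_maximal by blast
    qed
    ultimately have "multi_graph ?F \<subseteq> multi_graph G"
      by (auto simp: multi_graph_def two_valued_map_def)
    with less show False by blast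
  qed
  with usco show ?thesis by (auto simp: minimal_usco_def)
qed

lemma uncountable_nat_sets: "uncountable (UNIV :: nat set set)"
proof
  assume "countable (UNIV :: nat set set)"
  then have "range (from_nat_into (UNIV :: nat set set)) = Pow UNIV"
    by (simp add: range_from_nat_into)
  then show False using Cantors_theorem by blast
qed

text \<open>The compact set \<open>C\<close> below, which only says how small \<open>dist y\<^sub>1 y\<^sub>0\<close> has to be, is unrelated
  to the compact neighbourhood \<open>K\<close> on which the constructed maps are told apart. Local compactness
  supplies \<open>K\<close>, a single compact set that meets every \<open>B n\<close>.\<close>

lemma not_locally_ccc_space_MU:
  fixes x\<^sub>0 :: "'a::t2_space" and y\<^sub>0 :: "'b::metric_space"
  assumes lc: "locally_compact_space (euclidean :: 'a topology)"
    and x\<^sub>0: "\<not> open {x\<^sub>0}" and y\<^sub>0: "\<not> open {y\<^sub>0}"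
  shows "\<not> locally_ccc_space (MU_topology :: ('a \<Rightarrow> 'b set) topology)"
proof
  assume lccc: "locally_ccc_space (MU_topology :: ('a \<Rightarrow> 'b set) topology)"
  obtain y' where "y' \<noteq> y\<^sub>0"
  proof -
    have "UNIV \<noteq> {y\<^sub>0}" using y\<^sub>0 by (metis open_UNIV)
    then show ?thesis using that by blast
  qed
  \<comment> \<open>Any point other than \<open>y\<^sub>0\<close> serves to write the constant map as a two-valued map.\<close>
  have "two_valued_map {} y\<^sub>0 y' = (\<lambda>_::'a. {y\<^sub>0})" by (auto simp: two_valued_map_def)
  then have const: "(\<lambda>_::'a. {y\<^sub>0}) \<in> MU"
    using minimal_usco_two_valued_map[of "{} :: 'a set" y\<^sub>0 y'] \<open>y' \<noteq> y\<^sub>0\<close> by (simp add: MU_def)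
  then obtain U N where U: "openin MU_topology U" "(\<lambda>_::'a. {y\<^sub>0}) \<in> U" "U \<subseteq> N"
    and ccc: "ccc_space (subtopology MU_topology N)"
    using lccc unfolding locally_ccc_space_def topspace_MU_topology by metis
  obtain C \<epsilon> where \<epsilon>: "\<epsilon> > 0"
    "\<And>G. G \<in> MU \<Longrightarrow> (\<And>x. x \<in> C \<Longrightarrow> hausdorff_metric {y\<^sub>0} (G x) < \<epsilon>) \<Longrightarrow> G \<in> U"
    using openin_MU_topology_obtains[OF U(1,2)] by metis
  obtain y\<^sub>1 where y\<^sub>1: "y\<^sub>1 \<noteq> y\<^sub>0" "dist y\<^sub>1 y\<^sub>0 < \<epsilon>"
    using y\<^sub>0 \<epsilon>(1) unfolding open_dist by auto
  obtain O\<^sub>0 K where K: "open O\<^sub>0" "compact K" "x\<^sub>0 \<in> O\<^sub>0" "O\<^sub>0 \<subseteq> K"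
    using lc unfolding locally_compact_space_def by (simp, meson)
  obtain B :: "nat \<Rightarrow> 'a set" where B: "\<And>n. open (B n)" "\<And>n. B n \<noteq> {}" "\<And>n. B n \<subseteq> O\<^sub>0" "disjoint_family B"
    using nonisolated_point_disjoint_open_sequence[OF x\<^sub>0 K(1,3)] by metis
  define W where "W S = (\<Union>n\<in>S. B n)" for S
  define F where "F S = two_valued_map (W S) y\<^sub>0 y\<^sub>1" for S
  have openW: "open (W S)" for S using B(1) by (auto simp: W_def)
  have F_MU: "F S \<in> MU" for S
    using minimal_usco_two_valued_map[OF openW y\<^sub>1(1)[symmetric]] by (simp add: F_def MU_def)
  then have F_cv: "F S \<in> compact_valued" for S using MU_subset_compact_valued by blast
  have F_on: "F S x = {y\<^sub>1}" if "n \<in> S" "x \<in> B n" for S n x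
  proof -
    have "x \<in> W S" using that by (auto simp: W_def)
    moreover have "W S \<subseteq> interior (closure (W S))"
      using openW by (simp add: closure_subset interior_maximal)
    ultimately have "x \<in> interior (closure (W S))" by blast
    moreover from this have "x \<in> closure (W S)" using interior_subset by blast
    ultimately show ?thesis by (simp add: F_def two_valued_map_def)
  qed
  have F_off: "F S x = {y\<^sub>0}" if "n \<notin> S" "x \<in> B n" for S n x
  proof -
    have "B n \<inter> B m = {}" if "m \<in> S" for m
      using disjoint_family_onD[OF B(4), of n m] that \<open>n \<notin> S\<close> by auto
    then have "B n \<inter> W S = {}" by (auto simp: W_def)
    then have "x \<notin> closure (W S)"
      using open_Int_closure_eq_empty[OF B(1)] that(2) by blast
    moreover from this have "x \<notin> interior (closure (W S))" using interior_subset by blast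
    ultimately show ?thesis by (simp add: F_def two_valued_map_def)
  qed
  have F_U: "F S \<in> U" for S
  proof (rule \<epsilon>(2)[OF F_MU])
    fix x
    have cpt: "{y\<^sub>0} \<in> nonempty_compacts" "F S x \<in> nonempty_compacts"
      using F_cv[of S] by (auto simp: compact_valued_def nonempty_compacts_def)
    have dist_le: "dist y y\<^sub>0 \<le> dist y\<^sub>1 y\<^sub>0" if "y \<in> F S x" for y
      using that by (auto simp: F_def two_valued_map_def)
    obtain y where y: "y \<in> F S x" using cpt(2) by (auto simp: nonempty_compacts_def)
    then have "infdist y\<^sub>0 (F S x) \<le> dist y\<^sub>1 y\<^sub>0"
      using infdist_le2[OF y, of y\<^sub>0] dist_le[OF y] by (simp add: dist_commute)
    then have "hausdorff_metric {y\<^sub>0} (F S x) \<le> dist y\<^sub>1 y\<^sub>0"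
      using dist_le by (simp add: hausdorff_metric_le_iff[OF cpt])
    with y\<^sub>1(2) show "hausdorff_metric {y\<^sub>0} (F S x) < \<epsilon>" by simp
  qed
  define r where "r = dist y\<^sub>1 y\<^sub>0 / 2"
  have "r > 0" using y\<^sub>1(1) by (simp add: r_def)
  define V where "V S = uc_ball K (F S) r \<inter> U" for S
  have F_V: "F S \<in> V S" for S
    using uc_ball_centre[OF F_cv \<open>r > 0\<close>] F_U by (simp add: V_def)
  have disj: "disjnt (V S) (V T)" if "S \<noteq> T" for S T
  proof -
    obtain n where "n \<in> S \<longleftrightarrow> n \<notin> T" using \<open>S \<noteq> T\<close> by blast
    moreover obtain x where "x \<in> B n" using B(2) by blast
    ultimately have "hausdorff_metric (F S x) (F T x) = dist y\<^sub>1 y\<^sub>0"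
      using F_on[of n] F_off[of n] by (cases "n \<in> S") (auto simp: dist_commute)
    moreover have "x \<in> K" using \<open>x \<in> B n\<close> B(3) K(4) by blast
    ultimately have "disjnt (uc_ball K (F S) r) (uc_ball K (F T) r)"
      by (intro disjnt_uc_ball[OF F_cv F_cv]) (auto simp: r_def)
    then show ?thesis by (auto simp: V_def disjnt_iff)
  qed
  have "openin (subtopology MU_topology N) (V S)" for S
  proof -
    have "U \<subseteq> MU" using openin_subset[OF U(1)] by (simp add: topspace_MU_topology)
    have "openin MU_topology (uc_ball K (F S) r \<inter> MU)"
      using openin_uc_ball[OF K(2) F_cv] by (auto simp: MU_topology_def openin_subtopology)
    then have "openin MU_topology (uc_ball K (F S) r \<inter> MU \<inter> U)"
      using U(1) by (rule openin_Int)
    moreover have "uc_ball K (F S) r \<inter> MU \<inter> U = V S"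
      using \<open>U \<subseteq> MU\<close> by (auto simp: V_def)
    ultimately have "openin MU_topology (V S)" by simp
    moreover have "V S = V S \<inter> N" using U(3) by (auto simp: V_def)
    ultimately show ?thesis by (auto simp: openin_subtopology)
  qed
  moreover have "pairwise disjnt (range V)"
    using disj by (intro pairwiseI) (metis imageE)
  ultimately have "countable (range V)"
    using ccc by (auto simp: ccc_space_def)
  moreover have "inj V"
    using disj F_V by (intro injI) (metis disjnt_iff)
  ultimately show False
    using uncountable_nat_sets countable_image_inj_on by blast
qed

theorem theorem3p16:
  assumes "locally_compact_space (euclidean :: 'a::t2_space topology)"
    and "separable_space (euclidean :: 'b::metric_space topology)"
    and "(euclidean :: 'b topology) \<noteq> discrete_topology UNIV"
  shows "(ccc_space (MU_topology :: ('a \<Rightarrow> 'b set) topology) \<longleftrightarrow>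
            locally_ccc_space (MU_topology :: ('a \<Rightarrow> 'b set) topology)) \<and>
         (locally_ccc_space (MU_topology :: ('a \<Rightarrow> 'b set) topology) \<longleftrightarrow>
            (euclidean :: 'a topology) = discrete_topology UNIV)"
proof -
  obtain y\<^sub>0 :: 'b where "\<not> open {y\<^sub>0}"
    using assms(3) discrete_topology_unique[of "UNIV :: 'b set" euclidean] by auto
  then have "\<forall>x::'a. open {x}" if "locally_ccc_space (MU_topology :: ('a \<Rightarrow> 'b set) topology)"
    using not_locally_ccc_space_MU[OF assms(1)] that by blast
  moreover have "ccc_space (MU_topology :: ('a \<Rightarrow> 'b set) topology)" if "\<forall>x::'a. open {x}"
    using ccc_space_MU_if_discrete[OF _ assms(2)] that by blast
  moreover have "(euclidean :: 'a topology) = discrete_topology UNIV \<longleftrightarrow> (\<forall>x::'a. open {x})"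
    using discrete_topology_unique[of "UNIV :: 'a set" euclidean] by auto
  ultimately show ?thesis
    using locally_ccc_space_if_ccc_space by blast
qed

end
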